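(* For all integers $n\geq 0$ and $k\geq 2$, the map $$f:\mathcal{C}_n^{(k)}\longrightarrow \bigcup_{i=0}^{n}\mathrm{Com}_{i+1}(n+1)\times\mathcal{E}_i^{(k)},\qquad f(F)=(c,\mathcal{D}(F)),$$ is a bijection.
   Context: The triangular shape $\triangle_n$ is the set of cells $(r,c)$ (row $r$, column $c$) with $1\leq c\leq r\leq n$ (rows numbered top to bottom, columns left to right; row $r$ has $r$ cells). A $01$-filling of $\triangle_n$ assigns $0$ or $1$ to each cell. An SE-chain of length $k$ is a set of cells $(r_1,c_1),\dots,(r_k,c_k)$ filled with $1$ such that $r_1<\cdots<r_k$ and $c_1<\cdots<c_k$; it is proper if the smallest rectangle containing it lies in $\triangle_n$ (i.e. $c_k\leq r_1$). $\mathcal{C}_n^{(k)}$ is the set of $01$-fillings of $\triangle_n$ in which every row and every column contains at most one $1$ and there is no proper SE-chain of length $k$. For $j\in[n]$ the $j$-th corner hook is the union of row $j$ and column $j$; it is zero if it contains no $1$, nonzero otherwise. $\mathcal{E}_n^{(k)}$ is the subset of $\mathcal{C}_n^{(k)}$ of fillings with no zero corner hook ($\mathcal{E}_0^{(k)}$ consists of the empty filling). An $i$-composition of $m$ is a sequence $c_1\cdots c_i$ of positive integers summing to $m$; $\mathrm{Com}_i(m)$ is the set of these. For $F\in\mathcal{C}_n^{(k)}$, let $S=\{s_1<\dots<s_i\}$ be the set of $j\in[n]$ whose $j$-th corner hook is nonzero; then $c=c_1\cdots c_{i+1}\in\mathrm{Com}_{i+1}(n+1)$ is defined by $\{c_1,c_1+c_2,\dots,c_1+\cdots+c_i\}=S$,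 and $\mathcal{D}(F)$ is the $01$-filling of $\triangle_i$ whose cell $(a,b)$ has the entry of cell $(s_a,s_b)$ of $F$ (i.e. all cells of zero corner hooks are removed and the rest compressed). *)

theory Defs
  imports "HOL-Library.FuncSet"
begin

definition tri :: "nat \<Rightarrow> (nat \<times> nat) set" where
  "tri n = {(r, c). 1 \<le> c \<and> c \<le> r \<and> r \<le> n}"

text \<open>Fillings are extensional functions, so that two fillings of the same shape are equal as
  functions iff they agree on all cells of the shape.\<close>

type_synonym filling = "nat \<times> nat \<Rightarrow> nat"

definition fillings :: "nat \<Rightarrow> filling set" where
  "fillings n = tri n \<rightarrow>\<^sub>E {0, 1}"

text \<open>The chain of cells \<open>(r 1, c 1), \<dots>, (r k, c k)\<close> is given by its coordinate functions; only
  their values on \<open>{1..k}\<close> matter.\<close>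

definition SE_chain :: "nat \<Rightarrow> filling \<Rightarrow> nat \<Rightarrow> (nat \<Rightarrow> nat) \<Rightarrow> (nat \<Rightarrow> nat) \<Rightarrow> bool" where
  "SE_chain n F k r c \<longleftrightarrow>
     strict_mono_on {1..k} r \<and> strict_mono_on {1..k} c \<and>
     (\<forall>i\<in>{1..k}. (r i, c i) \<in> tri n \<and> F (r i, c i) = 1)"

text \<open>Since \<open>r\<close> and \<open>c\<close> increase along an SE-chain, \<open>{r 1..r k} \<times> {c 1..c k}\<close> is the smallest
  rectangle containing it.\<close>

definition proper_SE_chain :: "nat \<Rightarrow> filling \<Rightarrow> nat \<Rightarrow> (nat \<Rightarrow> nat) \<Rightarrow> (nat \<Rightarrow> nat) \<Rightarrow> bool" where
  "proper_SE_chain n F k r c \<longleftrightarrow>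
     SE_chain n F k r c \<and> {r 1..r k} \<times> {c 1..c k} \<subseteq> tri n"

definition C_fillings :: "nat \<Rightarrow> nat \<Rightarrow> filling set" where
  "C_fillings n k = {F \<in> fillings n.
     (\<forall>i\<in>{1..n}. card {c. (i, c) \<in> tri n \<and> F (i, c) = 1} \<le> 1) \<and>
     (\<forall>j\<in>{1..n}. card {r. (r, j) \<in> tri n \<and> F (r, j) = 1} \<le> 1) \<and>
     \<not> (\<exists>r c. proper_SE_chain n F k r c)}"

definition corner_hook :: "nat \<Rightarrow> nat \<Rightarrow> (nat \<times> nat) set" where
  "corner_hook n j = {(r, c) \<in> tri n. r = j} \<union> {(r, c) \<in> tri n. c = j}"

definition zero_hook :: "nat \<Rightarrow> filling \<Rightarrow> nat \<Rightarrow> bool" where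
  "zero_hook n F j \<longleftrightarrow> (\<forall>x\<in>corner_hook n j. F x \<noteq> 1)"

definition E_fillings :: "nat \<Rightarrow> nat \<Rightarrow> filling set" where
  "E_fillings n k = {F \<in> C_fillings n k. \<forall>j\<in>{1..n}. \<not> zero_hook n F j}"

definition Com :: "nat \<Rightarrow> nat \<Rightarrow> nat list set" where
  "Com i m = {cs. length cs = i \<and> (\<forall>x\<in>set cs. 0 < x) \<and> sum_list cs = m}"

definition nonzero_hooks :: "nat \<Rightarrow> filling \<Rightarrow> nat set" where
  "nonzero_hooks n F = {j \<in> {1..n}. \<not> zero_hook n F j}"

text \<open>The last partial sum, always \<open>n + 1\<close>, is left out.\<close>

definition hook_comp :: "nat \<Rightarrow> filling \<Rightarrow> nat list" where
  "hook_comp n F = (let S = nonzero_hooks n F; i = card S in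
     THE cs. cs \<in> Com (i + 1) (n + 1) \<and> (\<lambda>j. sum_list (take j cs)) ` {1..i} = S)"

text \<open>The list of the \<open>s\<close>'s is indexed from 0, hence the shifts.\<close>

definition compress :: "nat \<Rightarrow> filling \<Rightarrow> filling" where
  "compress n F = (let S = nonzero_hooks n F; s = sorted_list_of_set S in
     restrict (\<lambda>(a, b). F (s ! (a - 1), s ! (b - 1))) (tri (card S)))"

definition hook_decomp :: "nat \<Rightarrow> filling \<Rightarrow> nat list \<times> filling" where
  "hook_decomp n F = (hook_comp n F, compress n F)"

lemma proper_SE_chain_iff:
  assumes "1 \<le> k"
  shows "proper_SE_chain n F k r c \<longleftrightarrow> SE_chain n F k r c \<and> c k \<le> r 1"
proof (cases "SE_chain n F k r c")
  case True
  have mono: "r 1 \<le> r k" "c 1 \<le> c k"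
    using True assms strict_mono_on_leD[of "{1..k}" r 1 k] strict_mono_on_leD[of "{1..k}" c 1 k]
    by (simp_all add: SE_chain_def)
  have "1 \<le> c 1" "r k \<le> n"
    using True assms by (auto simp: SE_chain_def tri_def)
  with mono True show ?thesis
    by (auto simp: proper_SE_chain_def tri_def subset_iff)
qed (simp add: proper_SE_chain_def)

lemma E_fillings_0:
  assumes "1 \<le> k"
  shows "E_fillings 0 k = {\<lambda>_. undefined}"
proof -
  have tri: "tri 0 = {}"
    by (auto simp: tri_def)
  have "\<not> SE_chain 0 F k r c" for F r c
    using assms by (auto simp: SE_chain_def tri)
  then show ?thesis
    by (simp add: E_fillings_def C_fillings_def fillings_def proper_SE_chain_def tri)
qed

end

theory Submission
  imports Defs
begin

text \<open>Everything about a filling is read off the set of its cells with entry 1. The nonzero corner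
  hooks are exactly the rows and columns met by these cells, so if \<open>s\<close> enumerates the set \<open>S\<close> of
  nonzero hooks increasingly, then the ones of \<open>F\<close> are the image under \<open>s \<times> s\<close> of the ones of the
  compressed filling. A strictly increasing relabelling preserves and reflects all defining
  conditions, properness of chains (\<open>c k \<le> r 1\<close>) included. Hence \<open>F\<close> corresponds to the pair of \<open>S\<close>
  and its compression, and \<open>S\<close> corresponds to a composition by partial sums.\<close>

section \<open>Compositions and subsets\<close>

text \<open>The total is left out. On \<open>Com (card S + 1) (n + 1)\<close> the index range is the
  one in \<open>hook_comp\<close>, but here it does not mention \<open>S\<close>.\<close>

definition psums :: "nat list \<Rightarrow> nat set" where
  "psums cs = (\<lambda>j. sum_list (take j cs)) ` {1..length cs - 1}"

lemma psums_singleton [simp]: "psums [x] = {}"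
  by (simp add: psums_def)

lemma psums_snoc:
  assumes "cs \<in> Com (Suc i) m"
  shows "psums (cs @ [x]) = insert m (psums cs)"
proof -
  have cs: "length cs = Suc i" "sum_list cs = m"
    using assms by (simp_all add: Com_def)
  have "psums (cs @ [x]) = (\<lambda>j. sum_list (take j cs)) ` {1..Suc i}"
    using cs by (auto simp: psums_def intro!: image_cong)
  also have "{1..Suc i} = insert (Suc i) {1..i}"
    by auto
  finally show ?thesis
    using cs by (simp add: psums_def)
qed

lemma Com_1: "0 < m \<Longrightarrow> Com (Suc 0) m = {[m]}"
  by (auto simp: Com_def length_Suc_conv)

text \<open>Splitting off the last part: the total \<open>m\<close> of the remaining parts
  determines that part, and it will be the largest partial sum. At least one part remains, hence
  \<open>0 < m\<close>.\<close>

lemma Com_SucE: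
  assumes "cs \<in> Com (Suc (Suc i)) (Suc n)"
  obtains ds m where "cs = ds @ [Suc n - m]" "ds \<in> Com (Suc i) m" "0 < m" "m \<le> n"
proof -
  from assms obtain ds x where cs: "cs = ds @ [x]"
    by (cases cs rule: rev_cases) (auto simp: Com_def)
  with assms have "ds \<in> Com (Suc i) (sum_list ds)" "0 < x" "sum_list ds + x = Suc n"
    by (auto simp: Com_def)
  moreover from this(1) have "0 < sum_list ds"
    by (cases ds) (auto simp: Com_def)
  ultimately show thesis
    using that[of ds "sum_list ds"] cs by simp
qed

text \<open>Induction on the number of parts: restoring the last part adds the old total as a new
  partial sum, and it exceeds all earlier ones.\<close>

lemma psums_Com:
  assumes "cs \<in> Com (Suc i) (Suc n)"
  shows "psums cs \<subseteq> {1..n} \<and> card (psums cs) = i"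
  using assms
proof (induction i arbitrary: cs n)
  case 0
  then show ?case
    by (simp add: Com_1)
next
  case (Suc i)
  from Suc.prems obtain ds m
    where cs: "cs = ds @ [Suc n - m]" and ds: "ds \<in> Com (Suc i) m" and m: "0 < m" "m \<le> n"
    by (rule Com_SucE)
  \<comment> \<open>The induction hypothesis speaks of totals of the form
    \<open>Suc n\<close>.\<close>
  from m obtain m' where m': "m = Suc m'"
    by (cases m) auto
  from Suc.IH ds have IH: "psums ds \<subseteq> {1..m'}" "card (psums ds) = i"
    by (auto simp: m')
  have "psums cs = insert m (psums ds)"
    using psums_snoc[OF ds] by (simp add: cs)
  moreover have "m \<notin> psums ds" "finite (psums ds)"
    using IH m' finite_subset by (auto simp: psums_def)
  ultimately show ?case
    using IH m m' by auto
qed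

text \<open>Induction on the size of \<open>S\<close>, removing its maximum: the maximum has to be
  the total of all parts but the last, and this fixes the last part.\<close>

lemma ex1_Com_psums:
  assumes "S \<subseteq> {1..n}"
  shows "\<exists>!cs. cs \<in> Com (Suc (card S)) (Suc n) \<and> psums cs = S"
  using assms
proof (induction "card S" arbitrary: S n)
  case 0
  then have "S = {}"
    using finite_subset by fastforce
  then show ?case
    by (auto simp: Com_1)
next
  case (Suc i)
  have fin: "finite S"
    using Suc.prems finite_subset by blast
  define m where "m = Max S"
  have m: "m \<in> S" "\<And>x. x \<in> S \<Longrightarrow> x \<le> m"
    using fin Suc.hyps(2) by (auto simp: m_def intro!: Max_in)
  then have m_bounds: "0 < m" "m \<le> n"
    using Suc.prems by (force, force)
  have cardS: "i = card (S - {m})"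
    using Suc.hyps(2) m(1) fin by simp
  \<comment> \<open>The ground set shrinks to \<open>{1..m - 1}\<close>, so that the hypothesis
    yields compositions of \<open>m\<close>.\<close>
  have "S - {m} \<subseteq> {1..m - 1}"
    using m(2) Suc.prems by force
  from Suc.hyps(1)[OF cardS this]
  have IH: "\<exists>!ds. ds \<in> Com (Suc i) m \<and> psums ds = S - {m}"
    using m_bounds cardS by simp
  then obtain ds where ds: "ds \<in> Com (Suc i) m" "psums ds = S - {m}"
    by blast
  show ?case
  proof (rule ex1I[of _ "ds @ [Suc n - m]"])
    show "ds @ [Suc n - m] \<in> Com (Suc (card S)) (Suc n) \<and> psums (ds @ [Suc n - m]) = S"
      using ds m m_bounds by (auto simp: psums_snoc[OF ds(1)]) (auto simp: Com_def Suc.hyps(2)[symmetric])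
  next
    fix cs
    assume cs: "cs \<in> Com (Suc (card S)) (Suc n) \<and> psums cs = S"
    then obtain es l where es: "cs = es @ [Suc n - l]" "es \<in> Com (Suc i) l" "0 < l"
      unfolding Suc.hyps(2)[symmetric] by (auto elim: Com_SucE)
    have S: "S = insert l (psums es)"
      using cs es(1) psums_snoc[OF es(2)] by simp
    \<comment> \<open>The partial sums of \<open>es\<close> stay below its total \<open>l\<close>,
      so \<open>l\<close> is the maximum of \<open>S\<close>.\<close>
    have sub: "psums es \<subseteq> {1..l - 1}"
      using psums_Com[of es i "l - 1"] es by simp
    then have "\<And>x. x \<in> S \<Longrightarrow> x \<le> l"
      using S by force
    then have "l = m"
      using m S by (metis insertI1 le_antisym)
    moreover from this have "psums es = S - {m}"
      using S sub es by force
    ultimately show "cs = ds @ [Suc n - m]"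
      using IH ds es by blast
  qed
qed

section \<open>Fillings as sets of ones\<close>

definition ones :: "nat \<Rightarrow> filling \<Rightarrow> (nat \<times> nat) set" where
  "ones n F = {x \<in> tri n. F x = 1}"

lemma ones_subset: "ones n F \<subseteq> {1..n} \<times> {1..n}"
  by (auto simp: ones_def tri_def)

lemma fillings_eqI:
  assumes "F \<in> fillings n" "G \<in> fillings n" "ones n F = ones n G"
  shows "F = G"
proof (rule PiE_ext)
  show "F \<in> tri n \<rightarrow>\<^sub>E {0, 1}" "G \<in> tri n \<rightarrow>\<^sub>E {0, 1}"
    using assms by (simp_all add: fillings_def)
  fix x
  assume x: "x \<in> tri n"
  then have "F x \<in> {0, 1}" "G x \<in> {0, 1}"
    using assms unfolding fillings_def by (meson PiE_mem)+
  moreover have "F x = 1 \<longleftrightarrow> G x = 1"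
    using assms(3) x unfolding ones_def by blast
  ultimately show "F x = G x"
    by (metis empty_iff insert_iff)
qed

lemma ex_filling_ones:
  assumes "A \<subseteq> tri n"
  shows "\<exists>F\<in>fillings n. ones n F = A"
proof (rule bexI)
  let ?F = "restrict (\<lambda>x. if x \<in> A then 1 else 0) (tri n)"
  show "ones n ?F = A"
    using assms by (auto simp: ones_def)
  show "?F \<in> fillings n"
    by (simp add: fillings_def)
qed

text \<open>A cell lies in exactly the hooks indexed by its row and by its column. In this form the
  nonzero hooks are easily transported along images.\<close>

lemma nonzero_hooks_ones: "nonzero_hooks n F = fst ` ones n F \<union> snd ` ones n F"
proof -
  have "corner_hook n j = {x \<in> tri n. j = fst x \<or> j = snd x}" for j
    by (auto simp: corner_hook_def)
  then have "j \<in> nonzero_hooks n F \<longleftrightarrow> j \<in> {1..n} \<and> (\<exists>x\<in>ones n F. j = fst x \<or> j = snd x)" for j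
    unfolding nonzero_hooks_def zero_hook_def ones_def by blast
  moreover have "fst x \<in> {1..n}" "snd x \<in> {1..n}" if "x \<in> ones n F" for x
    using that ones_subset[of n F] by auto
  ultimately show ?thesis
    by blast
qed

lemma nonzero_hooks_subset: "nonzero_hooks n F \<subseteq> {1..n}"
  by (auto simp: nonzero_hooks_def)

text \<open>A proper SE-chain in terms of its cells alone: with properness written as
  \<open>c k \<le> r 1\<close>, the size of the triangle disappears.\<close>

definition ones_chain :: "(nat \<times> nat) set \<Rightarrow> nat \<Rightarrow> (nat \<Rightarrow> nat) \<Rightarrow> (nat \<Rightarrow> nat) \<Rightarrow> bool" where
  "ones_chain A k r c \<longleftrightarrow>
     strict_mono_on {1..k} r \<and> strict_mono_on {1..k} c \<and> (\<forall>i\<in>{1..k}. (r i, c i) \<in> A) \<and> c k \<le> r 1"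

lemma rows_iff:
  "(\<forall>i\<in>{1..n}. card {c. (i, c) \<in> tri n \<and> F (i, c) = 1} \<le> 1) \<longleftrightarrow> inj_on fst (ones n F)"
proof -
  have "card {c. (i, c) \<in> tri n \<and> F (i, c) = 1} \<le> 1 \<longleftrightarrow>
      (\<forall>c c'. (i, c) \<in> ones n F \<longrightarrow> (i, c') \<in> ones n F \<longrightarrow> c = c')" for i
  proof -
    have "finite {c. (i, c) \<in> tri n \<and> F (i, c) = 1}"
      by (rule finite_subset[of _ "{1..n}"]) (auto simp: tri_def)
    from card_le_Suc0_iff_eq[OF this] show ?thesis
      by (auto simp: ones_def)
  qed
  moreover have "inj_on fst (ones n F) \<longleftrightarrow>
      (\<forall>i c c'. (i, c) \<in> ones n F \<longrightarrow> (i, c') \<in> ones n F \<longrightarrow> c = c')"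
    by (force simp: inj_on_def)
  moreover have "i \<in> {1..n}" if "(i, c) \<in> ones n F" for i c
    using that ones_subset[of n F] by auto
  ultimately show ?thesis
    by meson
qed

lemma cols_iff:
  "(\<forall>j\<in>{1..n}. card {r. (r, j) \<in> tri n \<and> F (r, j) = 1} \<le> 1) \<longleftrightarrow> inj_on snd (ones n F)"
proof -
  have "card {r. (r, j) \<in> tri n \<and> F (r, j) = 1} \<le> 1 \<longleftrightarrow>
      (\<forall>r r'. (r, j) \<in> ones n F \<longrightarrow> (r', j) \<in> ones n F \<longrightarrow> r = r')" for j
  proof -
    have "finite {r. (r, j) \<in> tri n \<and> F (r, j) = 1}"
      by (rule finite_subset[of _ "{1..n}"]) (auto simp: tri_def)
    from card_le_Suc0_iff_eq[OF this] show ?thesis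
      by (auto simp: ones_def)
  qed
  moreover have "inj_on snd (ones n F) \<longleftrightarrow>
      (\<forall>j r r'. (r, j) \<in> ones n F \<longrightarrow> (r', j) \<in> ones n F \<longrightarrow> r = r')"
    by (force simp: inj_on_def)
  moreover have "j \<in> {1..n}" if "(r, j) \<in> ones n F" for j r
    using that ones_subset[of n F] by auto
  ultimately show ?thesis
    by meson
qed

lemma C_fillings_iff:
  assumes "1 \<le> k"
  shows "F \<in> C_fillings n k \<longleftrightarrow> F \<in> fillings n \<and> inj_on fst (ones n F) \<and> inj_on snd (ones n F) \<and>
    (\<nexists>r c. ones_chain (ones n F) k r c)"
  unfolding C_fillings_def mem_Collect_eq rows_iff cols_iff
  by (auto simp: proper_SE_chain_iff[OF assms] ones_chain_def SE_chain_def ones_def)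

section \<open>Strictly increasing relabellings\<close>

text \<open>Embeds the small triangle into the large one. Only the values of \<open>s\<close> on
  \<open>{1..i}\<close> are constrained.\<close>

locale relabelling =
  fixes i n :: nat and s :: "nat \<Rightarrow> nat"
  assumes mono: "strict_mono_on {1..i} s"
    and range: "s ` {1..i} \<subseteq> {1..n}"
begin

lemma inj: "inj_on s {1..i}"
  using mono by (rule strict_mono_on_imp_inj_on)

lemma less_iff: "a \<in> {1..i} \<Longrightarrow> b \<in> {1..i} \<Longrightarrow> s a < s b \<longleftrightarrow> a < b"
  using mono by (rule strict_mono_on_less)

lemma le_iff: "a \<in> {1..i} \<Longrightarrow> b \<in> {1..i} \<Longrightarrow> s a \<le> s b \<longleftrightarrow> a \<le> b"
  by (meson less_iff linorder_not_less)

text \<open>Lying in the triangle compares a column index with a row index; the same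
  \<open>s\<close> acts on both, so the comparison survives.\<close>

lemma tri_iff:
  assumes "a \<in> {1..i}" "b \<in> {1..i}"
  shows "(s a, s b) \<in> tri n \<longleftrightarrow> (a, b) \<in> tri i"
  using le_iff[of b a] assms range by (fastforce simp: tri_def image_subset_iff)

lemma inj_on_image_iff:
  assumes "A \<subseteq> {1..i} \<times> {1..i}"
  shows "inj_on fst (map_prod s s ` A) \<longleftrightarrow> inj_on fst A"
    and "inj_on snd (map_prod s s ` A) \<longleftrightarrow> inj_on snd A"
proof -
  have eq: "s (fst x) = s (fst y) \<longleftrightarrow> fst x = fst y" "s (snd x) = s (snd y) \<longleftrightarrow> snd x = snd y"
    if "x \<in> A" "y \<in> A" for x y
    using that assms by (auto intro!: inj_on_eq_iff[OF inj])
  show "inj_on fst (map_prod s s ` A) \<longleftrightarrow> inj_on fst A"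
    "inj_on snd (map_prod s s ` A) \<longleftrightarrow> inj_on snd A"
    by (simp_all add: inj_on_def prod_eq_iff eq cong: ball_cong)
qed

lemma ones_chain_image_iff:
  assumes A: "A \<subseteq> {1..i} \<times> {1..i}" and k: "1 \<le> k"
  shows "(\<exists>r c. ones_chain (map_prod s s ` A) k r c) \<longleftrightarrow> (\<exists>r c. ones_chain A k r c)"
proof
  assume "\<exists>r c. ones_chain A k r c"
  then obtain r c where ch: "ones_chain A k r c"
    by blast
  then have mem: "r j \<in> {1..i}" "c j \<in> {1..i}" if "j \<in> {1..k}" for j
    using that A unfolding ones_chain_def by blast+
  have "ones_chain (map_prod s s ` A) k (s \<circ> r) (s \<circ> c)"
    using ch k mem[of 1] mem[of k]
    by (auto simp: ones_chain_def strict_mono_on_def less_iff[OF mem(1) mem(1)]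
        less_iff[OF mem(2) mem(2)] le_iff)
  then show "\<exists>r c. ones_chain (map_prod s s ` A) k r c"
    by blast
next
  assume "\<exists>r c. ones_chain (map_prod s s ` A) k r c"
  then obtain r c where ch: "ones_chain (map_prod s s ` A) k r c"
    by blast
  \<comment> \<open>Each cell of the chain is pulled back to a cell of \<open>A\<close>;
    monotonicity of \<open>s\<close> then reflects all the inequalities.\<close>
  then have "\<forall>j\<in>{1..k}. \<exists>x. x \<in> A \<and> r j = s (fst x) \<and> c j = s (snd x)"
    by (fastforce simp: ones_chain_def)
  then obtain x where x: "\<And>j. j \<in> {1..k} \<Longrightarrow> x j \<in> A \<and> r j = s (fst (x j)) \<and> c j = s (snd (x j))"
    by metis
  have mem: "fst (x j) \<in> {1..i}" "snd (x j) \<in> {1..i}" if "j \<in> {1..k}" for j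
    using x[OF that] A by auto
  have "ones_chain A k (fst \<circ> x) (snd \<circ> x)"
    using ch k x mem
    by (simp add: ones_chain_def strict_mono_on_def less_iff le_iff)
  then show "\<exists>r c. ones_chain A k r c"
    by blast
qed

lemma C_fillings_image_iff:
  assumes "ones n F = map_prod s s ` ones i G" "F \<in> fillings n" "G \<in> fillings i" "1 \<le> k"
  shows "F \<in> C_fillings n k \<longleftrightarrow> G \<in> C_fillings i k"
  using assms ones_subset[of i G]
  by (simp add: C_fillings_iff inj_on_image_iff ones_chain_image_iff)

lemma nonzero_hooks_image:
  assumes "ones n F = map_prod s s ` ones i G"
  shows "nonzero_hooks n F = s ` nonzero_hooks i G"
  by (simp add: nonzero_hooks_ones assms image_Un image_image)

end

lemma E_fillings_iff: "G \<in> E_fillings i k \<longleftrightarrow> G \<in> C_fillings i k \<and> nonzero_hooks i G = {1..i}"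
  by (auto simp: E_fillings_def nonzero_hooks_def)

text \<open>Passes from list positions, counted from 0, to rows and columns, counted from 1. Only
  arguments in \<open>{1..card S}\<close> matter.\<close>

definition enum :: "nat set \<Rightarrow> nat \<Rightarrow> nat" where
  "enum S a = sorted_list_of_set S ! (a - 1)"

lemma enum_image:
  assumes "finite S"
  shows "enum S ` {1..card S} = S"
proof -
  have "enum S ` {1..card S} = (!) (sorted_list_of_set S) ` {..<card S}"
    by (force simp: enum_def image_iff Bex_def intro: exI[of _ "Suc _"])
  also have "\<dots> = S"
    using assms nth_image[of "card S" "sorted_list_of_set S"] by (simp add: lessThan_atLeast0)
  finally show ?thesis .
qed

lemma relabelling_enum:
  assumes "S \<subseteq> {1..n}"
  shows "relabelling (card S) n (enum S)"
proof
  have fin: "finite S"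
    using assms finite_subset by blast
  show "strict_mono_on {1..card S} (enum S)"
    using strict_sorted_list_of_set[of S]
    by (auto simp: strict_mono_on_def enum_def sorted_wrt_iff_nth_less)
  show "enum S ` {1..card S} \<subseteq> {1..n}"
    using enum_image[OF fin] assms by simp
qed

section \<open>The decomposition\<close>

lemma compress_eq:
  "compress n F = (let S = nonzero_hooks n F in
     restrict (\<lambda>(a, b). F (enum S a, enum S b)) (tri (card S)))"
  by (simp add: compress_def enum_def Let_def)

text \<open>Compression loses no entry 1: the row and the column of such a cell index nonzero hooks,
  so both lie in the range of \<open>enum S\<close>.\<close>

lemma compress_fillings:
  assumes "F \<in> fillings n" and S: "S = nonzero_hooks n F"
  shows "compress n F \<in> fillings (card S)"
    and "ones n F = map_prod (enum S) (enum S) ` ones (card S) (compress n F)"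
proof -
  have Sn: "S \<subseteq> {1..n}"
    using S nonzero_hooks_subset by simp
  then have fin: "finite S"
    using finite_subset by blast
  interpret relabelling "card S" n "enum S"
    using Sn by (rule relabelling_enum)
  have tri_enum: "(enum S a, enum S b) \<in> tri n" if "(a, b) \<in> tri (card S)" for a b
    using that tri_iff[of a b] by (auto simp: tri_def)
  show "compress n F \<in> fillings (card S)"
    unfolding compress_eq Let_def S[symmetric] fillings_def restrict_PiE_iff
    using assms(1) tri_enum by (auto simp: fillings_def dest!: PiE_mem)
  show "ones n F = map_prod (enum S) (enum S) ` ones (card S) (compress n F)"
  proof (intro subset_antisym subsetI)
    fix x
    assume x: "x \<in> ones n F"
    obtain r c where rc: "x = (r, c)"
      by fastforce
    have "r \<in> S" "c \<in> S"
      using x rc S by (force simp: nonzero_hooks_ones)+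
    then obtain a b where ab: "a \<in> {1..card S}" "b \<in> {1..card S}" "r = enum S a" "c = enum S b"
      using enum_image[OF fin] by (metis imageE)
    then have "(a, b) \<in> ones (card S) (compress n F)"
      using x rc tri_iff[of a b] by (simp add: ones_def compress_eq Let_def S[symmetric])
    then show "x \<in> map_prod (enum S) (enum S) ` ones (card S) (compress n F)"
      using rc ab by force
  next
    fix x
    assume "x \<in> map_prod (enum S) (enum S) ` ones (card S) (compress n F)"
    then show "x \<in> ones n F"
      using tri_enum by (auto simp: ones_def compress_eq Let_def S[symmetric])
  qed
qed

lemma compress_E_fillings:
  assumes "F \<in> C_fillings n k" "1 \<le> k" and S: "S = nonzero_hooks n F"
  shows "compress n F \<in> E_fillings (card S) k"
proof -
  have F: "F \<in> fillings n"
    using assms by (simp add: C_fillings_iff)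
  have Sn: "S \<subseteq> {1..n}"
    using S nonzero_hooks_subset by simp
  then have fin: "finite S"
    using finite_subset by blast
  interpret relabelling "card S" n "enum S"
    using Sn by (rule relabelling_enum)
  note comp = compress_fillings[OF F S]
  \<comment> \<open>Both sides are \<open>S\<close>; injectivity of \<open>enum S\<close> then shows
    that every hook of the compression is nonzero.\<close>
  have "enum S ` nonzero_hooks (card S) (compress n F) = enum S ` {1..card S}"
    using nonzero_hooks_image[OF comp(2)] S enum_image[OF fin] by simp
  then have "nonzero_hooks (card S) (compress n F) = {1..card S}"
    using inj_on_image_eq_iff[OF inj nonzero_hooks_subset subset_refl] by blast
  then show ?thesis
    using C_fillings_image_iff[OF comp(2) F comp(1)] assms by (simp add: E_fillings_iff)
qed

text \<open>The preimage puts the ones of \<open>G\<close> at their images under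
  \<open>enum S\<close>. As \<open>G\<close> has no zero hook, every element of \<open>S\<close>
  becomes a nonzero hook.\<close>

lemma compress_surj:
  assumes S: "S \<subseteq> {1..n}" and G: "G \<in> E_fillings (card S) k" and k: "1 \<le> k"
  shows "\<exists>F\<in>C_fillings n k. nonzero_hooks n F = S \<and> compress n F = G"
proof -
  interpret relabelling "card S" n "enum S"
    using S by (rule relabelling_enum)
  have fin: "finite S"
    using S finite_subset by blast
  have Gf: "G \<in> fillings (card S)"
    using G k by (simp add: E_fillings_iff C_fillings_iff)
  have "map_prod (enum S) (enum S) ` ones (card S) G \<subseteq> tri n"
    using tri_iff by (force simp: ones_def tri_def)
  then obtain F where F: "F \<in> fillings n"
    and onesF: "ones n F = map_prod (enum S) (enum S) ` ones (card S) G"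
    using ex_filling_ones by metis
  have hooks: "nonzero_hooks n F = S"
    using nonzero_hooks_image[OF onesF] G enum_image[OF fin] by (simp add: E_fillings_iff)
  note comp = compress_fillings[OF F hooks[symmetric]]
  have "inj_on (map_prod (enum S) (enum S)) ({1..card S} \<times> {1..card S})"
    using inj by (rule map_prod_inj_on) (rule inj)
  \<comment> \<open>Both sets have the image \<open>ones n F\<close> under the same injective
    map.\<close>
  then have "ones (card S) (compress n F) = ones (card S) G"
    using inj_on_image_eq_iff[OF _ ones_subset ones_subset] onesF comp(2) by metis
  then have "compress n F = G"
    using comp(1) Gf by (intro fillings_eqI)
  moreover have "F \<in> C_fillings n k"
    using C_fillings_image_iff[OF onesF F Gf k] G by (simp add: E_fillings_iff)
  ultimately show ?thesis
    using hooks by blast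
qed

text \<open>Eliminates the definite description. Injectivity of the decomposition uses it to recover
  the nonzero hooks from the composition, surjectivity to identify a given composition.\<close>

lemma hook_comp_unique:
  "cs \<in> Com (card (nonzero_hooks n F) + 1) (n + 1) \<and> psums cs = nonzero_hooks n F \<longleftrightarrow>
     cs = hook_comp n F"
proof -
  let ?S = "nonzero_hooks n F"
  have "psums ds = (\<lambda>j. sum_list (take j ds)) ` {1..card ?S}"
    if "ds \<in> Com (card ?S + 1) (n + 1)" for ds
    using that by (simp add: psums_def Com_def)
  then have "hook_comp n F = (THE cs. cs \<in> Com (card ?S + 1) (n + 1) \<and> psums cs = ?S)"
    unfolding hook_comp_def Let_def by (intro arg_cong[where f = The] ext) auto
  moreover have "\<exists>!cs. cs \<in> Com (card ?S + 1) (n + 1) \<and> psums cs = ?S"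
    using ex1_Com_psums[OF nonzero_hooks_subset] by simp
  ultimately show ?thesis
    using theI'[of "\<lambda>cs. cs \<in> Com (card ?S + 1) (n + 1) \<and> psums cs = ?S"] by auto
qed

theorem theorem2p2:
  fixes n k :: nat
  assumes "k \<ge> 2"
  shows "bij_betw (hook_decomp n) (C_fillings n k) (\<Union>i\<in>{0..n}. Com (i + 1) (n + 1) \<times> E_fillings i k)"
proof (rule bij_betw_imageI)
  have k: "1 \<le> k"
    using assms by simp
  note comp = hook_comp_unique[THEN iffD2, OF refl]
  show "inj_on (hook_decomp n) (C_fillings n k)"
  proof (rule inj_onI)
    fix F F'
    assume FF': "F \<in> C_fillings n k" "F' \<in> C_fillings n k"
    then have fill: "F \<in> fillings n" "F' \<in> fillings n"
      using k by (simp_all add: C_fillings_iff)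
    assume "hook_decomp n F = hook_decomp n F'"
    then have eq: "hook_comp n F = hook_comp n F'" "compress n F = compress n F'"
      by (simp_all add: hook_decomp_def)
    then have "nonzero_hooks n F = nonzero_hooks n F'"
      using comp by metis
    \<comment> \<open>Both are the image of the same compressed ones under the same
      enumeration.\<close>
    then have "ones n F = ones n F'"
      using compress_fillings(2)[OF fill(1) refl] compress_fillings(2)[OF fill(2) refl] eq(2)
      by simp
    with fill show "F = F'"
      by (rule fillings_eqI)
  qed
  show "hook_decomp n ` C_fillings n k = (\<Union>i\<in>{0..n}. Com (i + 1) (n + 1) \<times> E_fillings i k)"
  proof (intro subset_antisym subsetI)
    fix y
    assume "y \<in> hook_decomp n ` C_fillings n k"
    then obtain F where F: "F \<in> C_fillings n k" "y = (hook_comp n F, compress n F)"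
      by (auto simp: hook_decomp_def)
    have "card (nonzero_hooks n F) \<le> n"
      using card_mono[OF _ nonzero_hooks_subset] by fastforce
    then show "y \<in> (\<Union>i\<in>{0..n}. Com (i + 1) (n + 1) \<times> E_fillings i k)"
      using F comp compress_E_fillings[OF F(1) k refl] by fastforce
  next
    fix y
    assume "y \<in> (\<Union>i\<in>{0..n}. Com (i + 1) (n + 1) \<times> E_fillings i k)"
    then obtain i cs G where y: "y = (cs, G)" "cs \<in> Com (i + 1) (n + 1)" "G \<in> E_fillings i k"
      by auto
    \<comment> \<open>The set of nonzero hooks of the preimage is \<open>psums cs\<close>; its size
      \<open>i\<close> matches the triangle of \<open>G\<close>.\<close>
    then have ps: "psums cs \<subseteq> {1..n}" "card (psums cs) = i"
      using psums_Com[of cs i n] by simp_all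
    with y k obtain F where F: "F \<in> C_fillings n k" "nonzero_hooks n F = psums cs" "compress n F = G"
      using compress_surj by metis
    then have "hook_decomp n F = y"
      using hook_comp_unique[of cs n F] y ps by (simp add: hook_decomp_def)
    with F show "y \<in> hook_decomp n ` C_fillings n k"
      by blast
  qed
qed

end
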